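(* With parameter $g$, $$\int_0^\infty x\left(\frac{g\sinh gx}{\cosh^2 gx}\,e^{-x^2/\pi^2}+\frac{\sqrt{\pi}\,\sinh x}{\cosh^2 x}\,e^{-g^2x^2}\right)dx=\int_0^\infty \frac{e^{-x^2/\pi^2}}{\cosh gx}\,dx.$$
   Context: Here $g$ is a parameter for which no explicit range is specified; the identity generalizes one of Amdeberhan and Moll stated only for $g=\gamma$, the Euler constant. Notation: $\sinh gx=\sinh(gx)$, $\cosh gx=\cosh(gx)$, $\cosh^2 gx=(\cosh(gx))^2$. *)

theory Defs
  imports "HOL-Analysis.Analysis"
begin

end

theory Submission
  imports Defs "HOL-Complex_Analysis.Complex_Analysis" "HOL-Probability.Probability"
begin

text \<open>
  All integrands are even, so the identity may be proved over the whole real line. Integrating by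
  parts removes the hyperbolic sines and reduces the claim to
  \[ \sqrt\pi \int (1 - 2 g^2 x^2) e^{-g^2 x^2} \operatorname{sech} x \, dx
     = \int \frac{2 y^2}{\pi^2} e^{-y^2/\pi^2} \operatorname{sech} (g y) \, dy. \]
  This is Parseval's formula: up to normalisation, both sech and the Gaussian are their own Fourier
  transforms, so evaluating the double integral of
  \( \operatorname{sech} x \cdot (2 y^2/\pi^2) e^{-y^2/\pi^2} \cos (2 g x y/\pi) \)
  in the two possible orders gives both sides. The transform of sech comes from the residue of
  \( e^{iaz} / \cosh z \) in a rectangle of height \( \pi \). The argument is uniform in
  \( g \), including \( g = 0 \).
\<close>

section \<open>Decay bounds and integrals over the real line\<close>

lemma abs_le_one_plus_square: "\<bar>x\<bar> \<le> 1 + (x :: real)\<^sup>2"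
  using zero_le_power2[of "\<bar>x\<bar> - 1"] by (simp add: power2_diff)

lemma two_div_pi_square_le_1: "2 / pi\<^sup>2 \<le> 1"
  using power_mono[OF pi_ge_two, of 2] by simp

text \<open>The weight \<open>1 + x^2\<close> is squared because \<open>weighted_bound\<close>
  spends one factor on a quadratic numerator and keeps the other for the integrable majorant
  \<open>C / (1 + x^2)\<close>.\<close>

lemma square_le_cosh: "(1 + x\<^sup>2)\<^sup>2 \<le> 512 * cosh (x :: real)"
proof -
  \<comment> \<open>The base on the right is (4 + |x|)^2. Written this way, its square is 256 times
    a fourth power to which (1 + t/n)^n <= exp t applies with n = 4 and t = |x|.\<close>
  have "(1 + x\<^sup>2)\<^sup>2 \<le> (16 * (1 + \<bar>x\<bar> / 4)\<^sup>2)\<^sup>2"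
    by (intro power_mono) (auto simp: power2_eq_square field_simps)
  also have "\<dots> = 256 * (1 + \<bar>x\<bar> / real 4) ^ 4"
    by (simp add: power_mult_distrib)
  also have "\<dots> \<le> 256 * exp \<bar>x\<bar>"
    by (intro mult_left_mono exp_ge_one_plus_x_over_n_power_n) auto
  also have "\<dots> \<le> 512 * cosh \<bar>x\<bar>"
    by (simp add: cosh_field_def)
  finally show ?thesis by simp
qed

lemma square_le_exp_square:
  "(1 + x\<^sup>2)\<^sup>2 \<le> 4 * pi ^ 4 * exp (x\<^sup>2 / pi\<^sup>2)"
proof -
  have pi: "pi\<^sup>2 \<ge> 1"
    using pi_ge_two by (intro one_le_power) auto
  \<comment> \<open>The right side is 2 pi^2 + x^2, shaped for (1 + t/n)^n <= exp t with n = 2 and t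
    = x^2/pi^2.\<close>
  have "1 + x\<^sup>2 \<le> 2 * pi\<^sup>2 * (1 + x\<^sup>2 / pi\<^sup>2 / real 2)"
    using pi by (simp add: distrib_left)
  hence "(1 + x\<^sup>2)\<^sup>2 \<le> (2 * pi\<^sup>2 * (1 + x\<^sup>2 / pi\<^sup>2 / real 2))\<^sup>2"
    by (intro power_mono) auto
  also have "\<dots> = 4 * pi ^ 4 * (1 + x\<^sup>2 / pi\<^sup>2 / real 2)\<^sup>2"
    by (simp add: power_mult_distrib)
  also have "\<dots> \<le> 4 * pi ^ 4 * exp (x\<^sup>2 / pi\<^sup>2)"
    by (intro mult_left_mono exp_ge_one_plus_x_over_n_power_n)
       (auto intro: order_trans[of _ 0])
  finally show ?thesis .
qed

lemma integrable_inverse_one_plus_square: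
  "integrable lborel (\<lambda>x::real. C / (1 + x\<^sup>2))"
  using integrable_inverse_1_plus_square
  by (simp add: set_integrable_def divide_inverse)

lemma integrable_inverse_square_bound:
  fixes f :: "real \<Rightarrow> 'a :: {banach, second_countable_topology}"
  assumes "continuous_on UNIV f" "\<And>x. norm (f x) * (1 + x\<^sup>2) \<le> C"
  shows "integrable lborel f"
proof (rule Bochner_Integration.integrable_bound[OF integrable_inverse_one_plus_square[of C]])
  show "f \<in> borel_measurable lborel"
    using assms(1) by (simp add: borel_measurable_continuous_onI)
  have "norm (f x) \<le> C / (1 + x\<^sup>2)" for x
  proof -
    have "1 + x\<^sup>2 > 0" by (simp add: add_pos_nonneg)
    thus ?thesis using assms(2)[of x] by (simp add: pos_le_divide_eq)
  qed
  thus "AE x in lborel. norm (f x) \<le> norm (C / (1 + x\<^sup>2))"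
    by (auto intro!: AE_I2 intro: order_trans[OF _ abs_ge_self] simp only: real_norm_def)
qed

text \<open>A general weight \<open>w\<close> serves both sources of decay:
  \<open>w = cosh x\<close> for sech and \<open>w = exp (x^2 / pi^2)\<close> for the
  Gaussian.\<close>

lemma weighted_bound:
  fixes w q x :: real
  assumes "(1 + x\<^sup>2)\<^sup>2 \<le> K * w" "w > 0" "\<bar>q\<bar> \<le> c * (1 + x\<^sup>2)"
  shows "\<bar>q / w\<bar> * (1 + x\<^sup>2) \<le> c * K"
proof -
  have p: "1 + x\<^sup>2 > 0" by (simp add: add_pos_nonneg)
  have c: "c \<ge> 0" using order_trans[OF abs_ge_zero assms(3)] p by (simp add: zero_le_mult_iff)
  have "\<bar>q\<bar> * (1 + x\<^sup>2) \<le> c * (1 + x\<^sup>2) * (1 + x\<^sup>2)"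
    using assms(3) p by (intro mult_right_mono) auto
  also have "\<dots> \<le> c * (K * w)"
    using mult_left_mono[OF assms(1) c] by (simp add: power2_eq_square mult.assoc)
  finally show ?thesis using assms(2) by (simp add: abs_divide field_simps)
qed

text \<open>This is the form in which integration by parts is used: \<open>F\<close> is the boundary
  term, and its derivative \<open>f\<close> collects all the integrands to be related. The bound
  makes \<open>F\<close> vanish at both infinities.\<close>

lemma integral_derivative_eq_0:
  fixes F f :: "real \<Rightarrow> real"
  assumes F: "\<And>x. (F has_real_derivative f x) (at x)"
  assumes f: "continuous_on UNIV f" "integrable lborel f"
  assumes bound: "\<And>x. \<bar>F x\<bar> * (1 + x\<^sup>2) \<le> C"
  shows "(\<integral>x. f x \<partial>lborel) = 0"
proof -
  have b: "norm (F x) \<le> C / (1 + x\<^sup>2)" for x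
    using bound[of x] by (simp add: pos_le_divide_eq add_pos_nonneg)
  have t: "(F \<longlongrightarrow> 0) at_top"
  proof (rule Lim_null_comparison[OF always_eventually])
    show "\<forall>x. norm (F x) \<le> C / (1 + x\<^sup>2)" using b by blast
    show "((\<lambda>x::real. C / (1 + x\<^sup>2)) \<longlongrightarrow> 0) at_top"
      by real_asymp
  qed
  have t': "(F \<longlongrightarrow> 0) at_bot"
  proof (rule Lim_null_comparison[OF always_eventually])
    show "\<forall>x. norm (F x) \<le> C / (1 + x\<^sup>2)" using b by blast
    show "((\<lambda>x::real. C / (1 + x\<^sup>2)) \<longlongrightarrow> 0) at_bot"
      by real_asymp
  qed
  have "(LBINT x=-\<infinity>..\<infinity>. f x) = 0 - 0"
  proof (rule interval_integral_FTC_integrable)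
    show "((F \<circ> real_of_ereal) \<longlongrightarrow> 0) (at_right (- \<infinity>))" "((F \<circ> real_of_ereal) \<longlongrightarrow> 0) (at_left \<infinity>)"
      using t t' by (simp_all add: ereal_tendsto_simps)
  qed (use F f in \<open>auto simp: has_real_derivative_iff_has_vector_derivative[symmetric]
         set_integrable_def continuous_on_eq_continuous_at\<close>)
  thus ?thesis
    by (simp add: interval_lebesgue_integral_def set_lebesgue_integral_def)
qed

text \<open>Bridge from Lebesgue integrals over the line, where the analysis takes place, to the
  gauge integrals over the half-line in the theorem.\<close>

lemma integral_even_atLeast_0:
  fixes f :: "real \<Rightarrow> real"
  assumes f: "integrable lborel f" and even: "\<And>x. f (- x) = f x"
  shows "f integrable_on {0..}" "(\<integral>x. f x \<partial>lborel) = 2 * integral {0..} f"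
proof -
  have s: "set_integrable lborel A f" if "A \<in> sets borel" for A
    unfolding set_integrable_def using f that by (intro integrable_mult_indicator) auto
  have 0: "(f has_integral integral\<^sup>L lborel f) UNIV"
    using f by (rule has_integral_integral_lborel)
  from set_borel_integral_eq_integral(1)[OF s]
  have i: "f integrable_on {0..}" "f integrable_on {..0}" by auto
  thus "f integrable_on {0..}" by simp
  have "{x::real. - x \<le> 0} = {0..}" by auto
  hence "(LINT x:{..0}|lborel. f x) = (LINT x:{0..}|lborel. f x)"
    using set_integral_reflect[of "{..0}" f] by (simp add: even)
  hence "integral {..0} f = integral {0..} f"
    by (simp add: set_borel_integral_eq_integral(2)[OF s])
  \<comment> \<open>The half-lines overlap in a null set, so their integrals add.\<close>
  moreover have "{0..} \<inter> {..0} = {0::real}" by auto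
  hence "(f has_integral (integral {0..} f + integral {..0} f)) ({0..} \<union> {..0})"
    using i by (intro has_integral_Un integrable_integral) auto
  moreover have "{0..} \<union> {..0} = (UNIV :: real set)" by auto
  ultimately have "(f has_integral (2 * integral {0..} f)) UNIV" by simp
  with 0 show "(\<integral>x. f x \<partial>lborel) = 2 * integral {0..} f"
    by (rule has_integral_unique)
qed

section \<open>The Fourier transform of sech by residues\<close>

lemma norm_cosh_ge_sinh: "\<bar>sinh (Re z)\<bar> \<le> norm (cosh z)"
proof -
  have "norm (cosh z) = norm (exp z + exp (- z)) / 2"
    by (simp only: cosh_field_def norm_divide norm_numeral)
  \<comment> \<open>Reverse triangle inequality; the moduli are exp (Re z) and exp (- Re z). The
    result confines the zeros of cosh to the imaginary axis and later gives decay on the vertical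
    sides of the rectangle.\<close>
  moreover have "norm (exp z + exp (- z)) \<ge> \<bar>norm (exp z) - norm (exp (- z))\<bar>"
    by (metis norm_triangle_ineq3 diff_minus_eq_add norm_minus_cancel)
  ultimately show ?thesis
    by (simp add: sinh_field_def abs_divide)
qed

lemma cosh_i_of_real: "cosh (\<i> * of_real t) = of_real (cos t)"
  by (simp add: cosh_conv_cos flip: cos_of_real)

lemma sinh_i_of_real: "sinh (\<i> * of_real t) = \<i> * of_real (sin t)"
  by (simp add: sinh_conv_sin flip: sin_of_real)

text \<open>The zeros of cosh are i (pi/2 + k pi). The neighbours of i pi/2 lie exactly on the edges
  of this open strip, which leaves room around the closed rectangle of heights 0 to pi.\<close>

lemma cosh_eq_0_strip_iff:
  assumes "- (pi / 2) < Im z" "Im z < 3 * pi / 2"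
  shows "cosh z = 0 \<longleftrightarrow> z = Complex 0 (pi / 2)"
proof
  assume z: "cosh z = 0"
  with norm_cosh_ge_sinh[of z] have re: "Re z = 0" by simp
  have "cosh z = of_real (cos (Im z))"
    using re by (subst complex_eq[of z]) (simp add: cosh_i_of_real)
  with z have "cos (Im z) = 0" by simp
  then have s: "sin (Im z - pi / 2) = 0"
    by (simp add: sin_diff)
  have "Im z - pi / 2 = 0"
    by (rule sin_eq_0_pi[OF _ _ s]) (use assms in linarith)+
  with re show "z = Complex 0 (pi / 2)" by (simp add: complex_eq_iff)
next
  assume "z = Complex 0 (pi / 2)"
  hence "z = \<i> * of_real (pi / 2)" by (simp add: complex_eq_iff)
  thus "cosh z = 0" by (simp only: cosh_i_of_real) simp
qed

lemma holomorphic_on_cosh: "(cosh :: complex \<Rightarrow> complex) holomorphic_on A"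
proof -
  have *: "cosh = (\<lambda>z::complex. (exp z + exp (- z)) / 2)"
    by (simp add: fun_eq_iff cosh_field_def)
  show ?thesis by (subst *) (intro holomorphic_intros, auto)
qed

text \<open>The only pole enclosed is the simple one at i pi/2, with residue exp (- a pi/2) / i
  because sinh (i pi/2) = i. Hence the value does not depend on \<open>R\<close>.\<close>

lemma contour_integral_rectpath_sech:
  fixes a R :: real
  assumes R: "R > 0"
  defines "f \<equiv> \<lambda>z. exp (\<i> * of_real a * z) / cosh z"
  shows "contour_integral (rectpath (Complex (- R) 0) (Complex R pi)) f = of_real (2 * pi * exp (- (a * pi / 2)))"
proof -
  define S where "S = {z. Im z > - (pi / 2)} \<inter> {z. Im z < 3 * pi / 2}"
  define p where "p = Complex 0 (pi / 2)"
  let ?g = "rectpath (Complex (- R) 0) (Complex R pi)"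
  have "open S" unfolding S_def by (intro open_Int open_halfspace_Im_gt open_halfspace_Im_lt)
  moreover have "connected S" unfolding S_def
    by (intro convex_connected convex_Int convex_halfspace_Im_gt convex_halfspace_Im_lt)
  moreover have nz: "cosh z = 0 \<longleftrightarrow> z = p" if "z \<in> S" for z
    using cosh_eq_0_strip_iff[of z] that by (auto simp: S_def p_def)
  moreover have pS: "p \<in> S" by (simp add: p_def S_def)
  moreover have img: "path_image ?g \<subseteq> cbox (Complex (- R) 0) (Complex R pi)"
    using R by (intro path_image_rectpath_subset_cbox) auto
  moreover have sub: "cbox (Complex (- R) 0) (Complex R pi) \<subseteq> S"
    using pi_gt_zero by (auto simp: S_def in_cbox_complex_iff simp del: pi_gt_zero)
  moreover have "p \<notin> path_image ?g"
    using R by (subst path_image_rectpath) (auto simp: p_def)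
  ultimately have "contour_integral ?g f = 2 * pi * \<i> * (\<Sum>q\<in>{p}. winding_number ?g q * residue f q)"
    unfolding f_def using R
    by (intro Residue_theorem[of S] winding_number_rectpath_outside ballI allI impI)
       (auto intro!: holomorphic_intros holomorphic_on_cosh)
  hence "contour_integral ?g f = 2 * pi * \<i> * (winding_number ?g p * residue f p)" by simp
  moreover have "winding_number ?g p = 1"
    using R by (intro winding_number_rectpath) (auto simp: p_def in_box_complex_iff)
  moreover have "residue f p = exp (\<i> * of_real a * p) / sinh p"
    unfolding f_def
  proof (rule residue_simple_pole_deriv[where s = S])
    \<comment> \<open>The derivative of the denominator is nonzero at \<open>p\<close>, so the pole
      is simple.\<close>
    have "sinh p ^ 2 = - 1" using nz[OF pS] by (simp add: sinh_square_eq)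
    thus "sinh p \<noteq> 0" by auto
  qed (use \<open>open S\<close> \<open>connected S\<close> pS nz in \<open>auto intro!: holomorphic_intros holomorphic_on_cosh derivative_eq_intros\<close>)
  moreover have "sinh p = \<i>"
  proof -
    have p: "p = \<i> * of_real (pi / 2)" by (simp add: p_def complex_eq_iff)
    show ?thesis unfolding p by (simp only: sinh_i_of_real) simp
  qed
  moreover have "\<i> * of_real a * p = of_real (- (a * pi / 2))"
    by (simp add: p_def complex_eq_iff)
  ultimately have "contour_integral ?g f = 2 * pi * \<i> * (1 * (of_real (exp (- (a * pi / 2))) / \<i>))"
    by (simp only: exp_of_real)
  moreover have "x * \<i> * (1 * (y / \<i>)) = x * y" for x y :: complex
    by (simp add: complex_eq_iff algebra_simps)
  ultimately show ?thesis by (simp only: of_real_mult)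
qed

text \<open>Dominated convergence with majorant |f|. It passes from the bottom sides of growing
  rectangles to the integral over the line.\<close>

lemma integral_symmetric_interval_tendsto:
  fixes f :: "real \<Rightarrow> 'a :: euclidean_space"
  assumes f: "integrable lborel f"
  shows "(\<lambda>n. integral {- real n..real n} f) \<longlonglongrightarrow> (\<integral>x. f x \<partial>lborel)"
proof -
  have "set_integrable lborel {- real n..real n} f" for n
    unfolding set_integrable_def using f by (intro integrable_mult_indicator) auto
  from set_borel_integral_eq_integral(2)[OF this]
  have "integral {- real n..real n} f = (\<integral>x. indicator {- real n..real n} x *\<^sub>R f x \<partial>lborel)" for n
    by (simp add: set_lebesgue_integral_def)
  moreover have "(\<lambda>n. \<integral>x. indicator {- real n..real n} x *\<^sub>R f x \<partial>lborel) \<longlonglongrightarrow> (\<integral>x. f x \<partial>lborel)"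
  proof (rule integral_dominated_convergence)
    show "integrable lborel (\<lambda>x. norm (f x))"
      using f by (rule integrable_norm)
    show "AE x in lborel. (\<lambda>n. indicator {- real n..real n} x *\<^sub>R f x) \<longlonglongrightarrow> f x"
    proof
      fix x :: real
      obtain N where "\<bar>x\<bar> \<le> real N" using real_arch_simple by blast
      hence "eventually (\<lambda>n. indicator {- real n..real n} x *\<^sub>R f x = f x) sequentially"
        by (intro eventually_sequentiallyI[of N]) (auto simp: indicator_def)
      thus "(\<lambda>n. indicator {- real n..real n} x *\<^sub>R f x) \<longlonglongrightarrow> f x"
        by (rule tendsto_eventually)
    qed
  qed (use f in \<open>auto split: split_indicator\<close>)
  ultimately show ?thesis by simp
qed

text \<open>As the rectangle widens, its vertical sides contribute nothing in the limit, and the top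
  side is exp (- a pi) times the bottom one. So the integral times 1 + exp (- a pi) equals 2 pi exp
  (- a pi/2).\<close>

lemma fourier_sech:
  "(\<integral>x. cos (a * x) / cosh x \<partial>lborel) = pi / cosh (pi * a / 2)"
proof -
  define f where "f = (\<lambda>z. exp (\<i> * of_real a * z) / cosh z)"
  define A where "A = (\<lambda>R. contour_integral (linepath (Complex (- R) 0) (Complex R 0)) f)"
  define V where "V = (\<lambda>R. contour_integral (linepath (Complex R 0) (Complex R pi)) f)"
  have cont: "continuous_on (closed_segment u v) f"
    if "\<And>z. z \<in> closed_segment u v \<Longrightarrow> cosh z \<noteq> 0" for u v
    unfolding f_def using that by (intro continuous_intros) auto
  \<comment> \<open>The first alternative covers the vertical sides, the other two the horizontal
    ones, so \<open>f\<close> is continuous on the whole boundary.\<close>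
  have nz: "cosh z \<noteq> 0" if "Re z \<noteq> 0 \<or> Im z = 0 \<or> Im z = pi" for z
  proof -
    have "\<bar>sinh (Re z)\<bar> > 0" if "Re z \<noteq> 0" using that by simp
    moreover have "cosh z \<noteq> 0" if "Im z = 0 \<or> Im z = pi"
      using that pi_gt_zero cosh_eq_0_strip_iff[of z] by (auto simp: complex_eq_iff)
    ultimately show ?thesis using norm_cosh_ge_sinh[of z] that by fastforce
  qed
  have main: "A R * of_real (1 + exp (- (a * pi))) + V R - V (- R) = of_real (2 * pi * exp (- (a * pi / 2)))"
    if R: "R > 0" for R
  proof -
    let ?a1 = "Complex (- R) 0" and ?a2 = "Complex R 0" and ?a3 = "Complex R pi" and ?a4 = "Complex (- R) pi"
    have int: "f contour_integrable_on linepath ?a1 ?a2" "f contour_integrable_on linepath ?a2 ?a3"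
      "f contour_integrable_on linepath ?a3 ?a4" "f contour_integrable_on linepath ?a4 ?a1"
      using R by (auto intro!: contour_integrable_continuous_linepath cont nz
        simp: closed_segment_same_Re closed_segment_same_Im)
    \<comment> \<open>Shifting by i pi negates cosh, and the top side runs from right to left; the
      two signs cancel.\<close>
    have top: "contour_integral (linepath ?a3 ?a4) f = of_real (exp (- (a * pi))) * A R"
    proof -
      have shift: "f (z + \<i> * of_real pi) = - of_real (exp (- (a * pi))) * f z" for z
      proof -
        have "cosh (z + \<i> * of_real pi) = - cosh z"
          by (simp add: cosh_field_def exp_add exp_diff field_simps)
        moreover have "exp (\<i> * of_real a * (z + \<i> * of_real pi))
            = exp (of_real (- (a * pi))) * exp (\<i> * of_real a * z)"
          unfolding exp_add[symmetric] by (simp add: algebra_simps)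
        ultimately show ?thesis unfolding f_def by (simp add: exp_of_real del: of_real_minus of_real_mult)
      qed
      have l: "linepath ?a3 ?a4 t = linepath ?a2 ?a1 t + \<i> * of_real pi" for t
        by (simp add: linepath_def complex_eq_iff algebra_simps)
      have "contour_integral (linepath ?a3 ?a4) f = (?a4 - ?a3) * integral {0..1} (\<lambda>t. f (linepath ?a3 ?a4 t))"
        by (simp add: contour_integral_integral)
      also have "\<dots> = - of_real (exp (- (a * pi))) * ((?a1 - ?a2) * integral {0..1} (\<lambda>t. f (linepath ?a2 ?a1 t)))"
        unfolding l shift by (simp add: complex_eq_iff)
      also have "(?a1 - ?a2) * integral {0..1} (\<lambda>t. f (linepath ?a2 ?a1 t)) = contour_integral (linepath ?a2 ?a1) f"
        by (simp add: contour_integral_integral)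
      also have "\<dots> = - A R" unfolding A_def
        using int by (intro contour_integral_reverse_linepath cont nz) (auto simp: closed_segment_same_Im)
      finally show ?thesis by simp
    qed
    have side: "contour_integral (linepath ?a4 ?a1) f = - V (- R)"
      unfolding V_def using R
      by (intro contour_integral_reverse_linepath cont nz) (auto simp: closed_segment_same_Re)
    have "contour_integral (rectpath ?a1 ?a3) f = A R + V R + of_real (exp (- (a * pi))) * A R - V (- R)"
      unfolding rectpath_def Let_def using int
      by (simp add: contour_integrable_joinI valid_path_join top side A_def V_def)
    thus ?thesis
      using contour_integral_rectpath_sech[OF R, of a] by (simp add: f_def algebra_simps)
  qed
  \<comment> \<open>On this side exp (i a z) has modulus exp (- a Im z), at most exp (|a| pi), and
    cosh has modulus at least |sinh R|; the last factor pi is the length. Allowing negative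
    \<open>R\<close> covers both vertical sides.\<close>
  have V: "norm (V R) \<le> exp (\<bar>a\<bar> * pi) / \<bar>sinh R\<bar> * pi" if R: "R \<noteq> 0" for R
  proof -
    have "norm (V R) \<le> exp (\<bar>a\<bar> * pi) / \<bar>sinh R\<bar> * norm (Complex R pi - Complex R 0)"
      unfolding V_def
    proof (rule contour_integral_bound_linepath)
      fix z assume z: "z \<in> closed_segment (Complex R 0) (Complex R pi)"
      hence z': "Re z = R" "0 \<le> Im z" "Im z \<le> pi"
        by (auto simp: closed_segment_same_Re closed_segment_eq_real_ivl)
      have "- (a * Im z) \<le> \<bar>a\<bar> * \<bar>Im z\<bar>"
        unfolding abs_mult[symmetric] by (rule abs_ge_minus_self)
      also have "\<dots> \<le> \<bar>a\<bar> * pi"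
        using z' by (intro mult_left_mono) auto
      finally have "norm (exp (\<i> * of_real a * z)) \<le> exp (\<bar>a\<bar> * pi)"
        by simp
      thus "norm (f z) \<le> exp (\<bar>a\<bar> * pi) / \<bar>sinh R\<bar>"
        unfolding f_def norm_divide using R norm_cosh_ge_sinh[of z] z'
        by (intro frac_le) auto
    qed (use R in \<open>auto intro!: contour_integrable_continuous_linepath cont nz simp: closed_segment_same_Re\<close>)
    also have "norm (Complex R pi - Complex R 0) = pi"
      by (simp add: cmod_def)
    finally show ?thesis .
  qed
  have lim: "(\<lambda>n. exp (\<bar>a\<bar> * pi) / \<bar>sinh (real n)\<bar> * pi) \<longlonglongrightarrow> 0"
    unfolding sinh_field_def by real_asymp
  have V1: "(\<lambda>n. V (real n)) \<longlonglongrightarrow> 0"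
  proof (rule Lim_null_comparison[OF eventually_sequentiallyI lim])
    show "norm (V (real n)) \<le> exp (\<bar>a\<bar> * pi) / \<bar>sinh (real n)\<bar> * pi" if "n \<ge> 1" for n
      using that by (intro V) auto
  qed
  have V2: "(\<lambda>n. V (- real n)) \<longlonglongrightarrow> 0"
  proof (rule Lim_null_comparison[OF eventually_sequentiallyI lim])
    show "norm (V (- real n)) \<le> exp (\<bar>a\<bar> * pi) / \<bar>sinh (real n)\<bar> * pi" if "n \<ge> 1" for n
      using V[of "- real n"] that by simp
  qed
  define h where "h = (\<lambda>x::real. f (of_real x))"
  have cosh_r: "cosh (complex_of_real x) = of_real (cosh x)" for x
    by (simp add: cosh_field_def flip: exp_of_real)
  have h_int: "integrable lborel h"
  proof (rule integrable_inverse_square_bound)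
    show "continuous_on UNIV h"
      unfolding h_def f_def by (intro continuous_intros) (auto intro!: nz)
    show "norm (h x) * (1 + x\<^sup>2) \<le> 1 * 512" for x
      using weighted_bound[OF square_le_cosh[of x], of 1 1]
      by (simp add: h_def f_def norm_divide cosh_r)
  qed
  have Alim: "(\<lambda>n. A (real n)) \<longlonglongrightarrow> (\<integral>x. h x \<partial>lborel)"
  proof (rule Lim_transform_eventually[OF integral_symmetric_interval_tendsto[OF h_int]])
    show "eventually (\<lambda>n. integral {- real n..real n} h = A (real n)) sequentially"
      unfolding A_def h_def
      by (intro eventually_sequentiallyI[of 1], subst contour_integral_linepath_Reals_eq)
         (auto simp: complex_is_Real_iff)
  qed
  have "(\<lambda>n. A (real n) * of_real (1 + exp (- (a * pi))) + V (real n) - V (- real n))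
    \<longlonglongrightarrow> (\<integral>x. h x \<partial>lborel) * of_real (1 + exp (- (a * pi))) + 0 - 0"
    by (intro tendsto_intros Alim V1 V2)
  \<comment> \<open>By \<open>main\<close> the sequence is constant from n = 1 on; at n = 0 the
    rectangle degenerates.\<close>
  moreover have "(\<lambda>n. A (real n) * of_real (1 + exp (- (a * pi))) + V (real n) - V (- real n))
    \<longlonglongrightarrow> of_real (2 * pi * exp (- (a * pi / 2)))"
    by (intro tendsto_eventually eventually_sequentiallyI[of 1] main) auto
  ultimately have "(\<integral>x. h x \<partial>lborel) * of_real (1 + exp (- (a * pi))) = of_real (2 * pi * exp (- (a * pi / 2)))"
    using LIMSEQ_unique by fastforce
  hence "Re ((\<integral>x. h x \<partial>lborel) * of_real (1 + exp (- (a * pi)))) = 2 * pi * exp (- (a * pi / 2))"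
    by simp
  hence "(\<integral>x. Re (h x) \<partial>lborel) * (1 + exp (- (a * pi))) = 2 * pi * exp (- (a * pi / 2))"
    using h_int by simp
  moreover have "Re (h x) = cos (a * x) / cosh x" for x
    by (simp add: h_def f_def cosh_r Re_divide_of_real Re_exp)
  \<comment> \<open>Extracting exp (- a pi/2) lets it cancel against the residue and leaves the cosh
    of the claim.\<close>
  moreover have "1 + exp (- (a * pi)) = exp (- (a * pi / 2)) * (2 * cosh (pi * a / 2))"
  proof -
    have "exp (- (a * pi)) = exp (- (a * pi / 2)) * exp (- (a * pi / 2))"
      unfolding mult_exp_exp by simp
    moreover have "exp (- (a * pi / 2)) * exp (a * pi / 2) = 1"
      unfolding mult_exp_exp by simp
    ultimately show ?thesis by (simp add: cosh_field_def distrib_left mult.commute)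
  qed
  ultimately have "(\<integral>x. cos (a * x) / cosh x \<partial>lborel) * (exp (- (a * pi / 2)) * (2 * cosh (pi * a / 2)))
      = 2 * pi * exp (- (a * pi / 2))"
    by (simp only:)
  thus ?thesis by (simp add: field_simps)
qed

section \<open>Cosine transforms of the Gaussian and its second moment\<close>

lemma gauss_bound:
  assumes "\<bar>q\<bar> \<le> c * (1 + x\<^sup>2)"
  shows "\<bar>q * exp (- (x\<^sup>2 / pi\<^sup>2))\<bar> * (1 + x\<^sup>2) \<le> c * (4 * pi ^ 4)"
  using weighted_bound[OF square_le_exp_square exp_gt_zero assms]
  by (simp add: exp_minus divide_inverse)

lemma integrable_gauss:
  assumes "continuous_on UNIV q" "\<And>x. \<bar>q x\<bar> \<le> c * (1 + x\<^sup>2)"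
  shows "integrable lborel (\<lambda>x. q x * exp (- (x\<^sup>2 / pi\<^sup>2)))"
proof (rule integrable_inverse_square_bound)
  show "continuous_on UNIV (\<lambda>x. q x * exp (- (x\<^sup>2 / pi\<^sup>2)))"
    using assms(1) by (intro continuous_intros) auto
  show "norm (q x * exp (- (x\<^sup>2 / pi\<^sup>2))) * (1 + x\<^sup>2) \<le> c * (4 * pi ^ 4)" for x
    using gauss_bound[OF assms(2)] by simp
qed

lemma integrable_sech:
  fixes q :: "real \<Rightarrow> real"
  assumes "continuous_on UNIV q" "\<And>x. \<bar>q x\<bar> \<le> c * (1 + x\<^sup>2)"
  shows "integrable lborel (\<lambda>x. q x / cosh x)"
proof (rule integrable_inverse_square_bound)
  show "continuous_on UNIV (\<lambda>x. q x / cosh x)"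
    using assms(1) by (intro continuous_intros) auto
  show "norm (q x / cosh x) * (1 + x\<^sup>2) \<le> c * 512" for x
    using weighted_bound[OF square_le_cosh _ assms(2)] by simp
qed

text \<open>The integral is the real part of the characteristic function of the standard normal
  distribution.\<close>

lemma integral_std_normal_cos:
  "(\<integral>x. std_normal_density x * cos (t * x) \<partial>lborel) = exp (- (t\<^sup>2 / 2))"
proof -
  interpret real_distribution std_normal_distribution
    by (rule real_dist_normal_dist)
  have int: "integrable std_normal_distribution (\<lambda>x. exp (\<i> * complex_of_real (t * x)))"
    by (rule integrable_const_bound[of _ 1]) auto
  have "(\<integral>x. std_normal_density x * cos (t * x) \<partial>lborel) = (\<integral>x. cos (t * x) \<partial>std_normal_distribution)"
    by (subst integral_density) auto
  also have "\<dots> = (\<integral>x. Re (exp (\<i> * complex_of_real (t * x))) \<partial>std_normal_distribution)"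
    by (simp add: Re_exp)
  also have "\<dots> = Re (char std_normal_distribution t)"
    unfolding char_def by (rule integral_Re[OF int])
  also have "\<dots> = exp (- (t\<^sup>2 / 2))"
    by (simp add: char_std_normal_distribution)
  finally show ?thesis .
qed

lemma fourier_gauss:
  "(\<integral>y. exp (- (y\<^sup>2 / pi\<^sup>2)) * cos (c * y) \<partial>lborel) = pi * sqrt pi * exp (- (c\<^sup>2 * pi\<^sup>2 / 4))"
proof -
  \<comment> \<open>Chosen so that (r y)^2 / 2 = y^2/pi^2; the constant r / sqrt (2 pi) then becomes
    1 / (pi sqrt pi).\<close>
  define r where "r = sqrt 2 / pi"
  have r: "r > 0" by (simp add: r_def)
  have "exp (- ((c / r)\<^sup>2 / 2)) = r * (\<integral>y. std_normal_density (r * y) * cos (c / r * (r * y)) \<partial>lborel)"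
    using lborel_integral_real_affine[of r "\<lambda>x. std_normal_density x * cos (c / r * x)" 0] r
    unfolding integral_std_normal_cos by simp
  also have "(\<lambda>y. std_normal_density (r * y) * cos (c / r * (r * y)))
      = (\<lambda>y. 1 / sqrt (2 * pi) * (exp (- (y\<^sup>2 / pi\<^sup>2)) * cos (c * y)))"
    using r by (simp add: fun_eq_iff std_normal_density_def r_def power_mult_distrib power_divide)
  also have "r * (\<integral>y. 1 / sqrt (2 * pi) * (exp (- (y\<^sup>2 / pi\<^sup>2)) * cos (c * y)) \<partial>lborel)
     = (\<integral>y. exp (- (y\<^sup>2 / pi\<^sup>2)) * cos (c * y) \<partial>lborel) / (pi * sqrt pi)"
    by (simp add: r_def real_sqrt_mult)
  also have "(c / r)\<^sup>2 / 2 = c\<^sup>2 * pi\<^sup>2 / 4"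
    by (simp add: r_def power_divide power_mult_distrib)
  finally show ?thesis by (simp add: field_simps)
qed

text \<open>Instead of differentiating twice under the integral in \<open>c\<close>, the proof finds
  an explicit antiderivative of the difference \<open>f\<close> of the integrands, reducing the
  claim to \<open>fourier_gauss\<close>.\<close>

lemma fourier_gauss_second_moment:
  "(\<integral>y. 2 * y\<^sup>2 / pi\<^sup>2 * exp (- (y\<^sup>2 / pi\<^sup>2)) * cos (c * y) \<partial>lborel)
    = (1 - c\<^sup>2 * pi\<^sup>2 / 2) * (pi * sqrt pi * exp (- (c\<^sup>2 * pi\<^sup>2 / 4)))"
proof -
  define f where "f = (\<lambda>y. (1 - c\<^sup>2 * pi\<^sup>2 / 2) * (exp (- (y\<^sup>2 / pi\<^sup>2)) * cos (c * y)) - 2 * y\<^sup>2 / pi\<^sup>2 * exp (- (y\<^sup>2 / pi\<^sup>2)) * cos (c * y))"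
  have i1: "integrable lborel (\<lambda>y. exp (- (y\<^sup>2 / pi\<^sup>2)) * cos (c * y))"
    using integrable_gauss[of "\<lambda>y. cos (c * y)" 1]
    by (simp add: mult.commute continuous_intros order_trans[OF abs_cos_le_one])
  have i2: "integrable lborel (\<lambda>y. 2 * y\<^sup>2 / pi\<^sup>2 * exp (- (y\<^sup>2 / pi\<^sup>2)) * cos (c * y))"
  proof -
    have "\<bar>2 * y\<^sup>2 / pi\<^sup>2 * cos (c * y)\<bar> \<le> 1 * (1 + y\<^sup>2)" for y
    proof -
      have "\<bar>2 * y\<^sup>2 / pi\<^sup>2 * cos (c * y)\<bar> \<le> 2 / pi\<^sup>2 * y\<^sup>2 * 1"
        unfolding abs_mult[of "2 * y\<^sup>2 / pi\<^sup>2"] by (intro mult_mono) auto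
      also have "\<dots> \<le> 1 * y\<^sup>2" using two_div_pi_square_le_1 by (simp only: mult_1_right) (intro mult_right_mono, auto)
      finally show ?thesis by simp
    qed
    hence "integrable lborel (\<lambda>y. 2 * y\<^sup>2 / pi\<^sup>2 * cos (c * y) * exp (- (y\<^sup>2 / pi\<^sup>2)))"
      by (intro integrable_gauss[of _ 1] continuous_intros) auto
    thus ?thesis by (simp only: ac_simps)
  qed
  have "(\<integral>y. f y \<partial>lborel) = 0"
  proof (rule integral_derivative_eq_0)
    \<comment> \<open>The sine term is chosen so that, multiplied by the derivative of the Gaussian,
      it cancels the c y sin (c y) that comes from differentiating the cosine.\<close>
    show "((\<lambda>y. (y * cos (c * y) - c * pi\<^sup>2 / 2 * sin (c * y)) * exp (- (y\<^sup>2 / pi\<^sup>2))) has_real_derivative f y) (at y)" for y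
      unfolding f_def
      by (rule derivative_eq_intros refl | simp)+ (simp add: field_simps power2_eq_square power4_eq_xxxx)
    show "continuous_on UNIV f" unfolding f_def by (intro continuous_intros) auto
    show "integrable lborel f" unfolding f_def using i1 i2 by simp
    show "\<bar>(y * cos (c * y) - c * pi\<^sup>2 / 2 * sin (c * y)) * exp (- (y\<^sup>2 / pi\<^sup>2))\<bar> * (1 + y\<^sup>2)
       \<le> (1 + \<bar>c * pi\<^sup>2 / 2\<bar>) * (4 * pi ^ 4)" for y
    proof (rule gauss_bound)
      have "\<bar>y * cos (c * y)\<bar> \<le> 1 + y\<^sup>2"
        unfolding abs_mult
        using mult_mono[OF abs_le_one_plus_square[of y] abs_cos_le_one[of "c * y"]] by simp
      moreover have "\<bar>c * pi\<^sup>2 / 2 * sin (c * y)\<bar> \<le> \<bar>c * pi\<^sup>2 / 2\<bar> * (1 + y\<^sup>2)"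
        unfolding abs_mult[of "c * pi\<^sup>2 / 2"]
        by (intro mult_left_mono order_trans[OF abs_sin_le_one]) auto
      ultimately show "\<bar>y * cos (c * y) - c * pi\<^sup>2 / 2 * sin (c * y)\<bar> \<le> (1 + \<bar>c * pi\<^sup>2 / 2\<bar>) * (1 + y\<^sup>2)"
        unfolding distrib_right[of 1] mult_1 by (rule order_trans[OF abs_triangle_ineq4 add_mono])
    qed
  qed
  moreover have "(\<integral>y. f y \<partial>lborel) = (1 - c\<^sup>2 * pi\<^sup>2 / 2) * (pi * sqrt pi * exp (- (c\<^sup>2 * pi\<^sup>2 / 4)))
      - (\<integral>y. 2 * y\<^sup>2 / pi\<^sup>2 * exp (- (y\<^sup>2 / pi\<^sup>2)) * cos (c * y) \<partial>lborel)"
    unfolding f_def fourier_gauss[symmetric]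
    by (subst Bochner_Integration.integral_diff[OF integrable_mult_right[OF i1] i2]) (simp only: integral_mult_right_zero)
  ultimately show ?thesis by simp
qed

section \<open>Parseval's formula by Fubini\<close>

lemma integrable_lborel_product_bounded:
  fixes f h :: "real \<Rightarrow> real" and k :: "real \<Rightarrow> real \<Rightarrow> real"
  assumes f: "integrable lborel f" and h: "integrable lborel h"
    and k: "case_prod k \<in> borel_measurable (lborel \<Otimes>\<^sub>M lborel)" "\<And>x y. \<bar>k x y\<bar> \<le> 1"
  shows "integrable (lborel \<Otimes>\<^sub>M lborel) (\<lambda>(x, y). f x * h y * k x y)"
proof -
  note [measurable] = borel_measurable_integrable[OF f] borel_measurable_integrable[OF h] k(1)
  have "integrable (lborel \<Otimes>\<^sub>M lborel) (\<lambda>(x, y). f x * h y)"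
    by (rule lborel_pair.Fubini_integrable) (use f h in \<open>auto simp: abs_mult\<close>)
  thus ?thesis
  proof (rule Bochner_Integration.integrable_bound)
    show "AE z in lborel \<Otimes>\<^sub>M lborel. norm (case z of (x, y) \<Rightarrow> f x * h y * k x y) \<le> norm (case z of (x, y) \<Rightarrow> f x * h y)"
      using k(2) by (intro AE_I2) (auto simp: abs_mult mult_left_le split: prod.split)
  qed measurable
qed

lemma integral_sech_gauss_dual:
  "sqrt pi * (\<integral>x. (1 - 2 * g\<^sup>2 * x\<^sup>2) * exp (- (g\<^sup>2 * x\<^sup>2)) / cosh x \<partial>lborel)
    = (\<integral>y. 2 * y\<^sup>2 / pi\<^sup>2 * exp (- (y\<^sup>2 / pi\<^sup>2)) / cosh (g * y) \<partial>lborel)"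
proof -
  \<comment> \<open>This frequency fits both transforms: sech at \<open>c * y\<close> gives pi /
    cosh (g y), and (c x)^2 pi^2 / 4 = g^2 x^2 in the Gaussian.\<close>
  define c where "c = 2 * g / pi"
  define h where "h = (\<lambda>y. 2 * y\<^sup>2 / pi\<^sup>2 * exp (- (y\<^sup>2 / pi\<^sup>2)))"
  have "integrable lborel (\<lambda>x::real. 1 / cosh x)"
    by (rule integrable_sech[of _ 1]) auto
  moreover have "integrable lborel h"
    unfolding h_def
  proof (rule integrable_gauss)
    show "\<bar>2 * y\<^sup>2 / pi\<^sup>2\<bar> \<le> 1 * (1 + y\<^sup>2)" for y
      using mult_right_mono[OF two_div_pi_square_le_1, of "y\<^sup>2"] by simp
  qed (auto intro!: continuous_intros)
  ultimately have "integrable (lborel \<Otimes>\<^sub>M lborel) (\<lambda>(x, y). 1 / cosh x * h y * cos (c * y * x))"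
    by (rule integrable_lborel_product_bounded) auto
  hence "(\<integral>y. (\<integral>x. 1 / cosh x * h y * cos (c * y * x) \<partial>lborel) \<partial>lborel)
      = (\<integral>x. (\<integral>y. 1 / cosh x * h y * cos (c * y * x) \<partial>lborel) \<partial>lborel)"
    by (rule lborel_pair.Fubini_integral)
  also have "(\<lambda>y. \<integral>x. 1 / cosh x * h y * cos (c * y * x) \<partial>lborel) = (\<lambda>y. pi * (h y / cosh (g * y)))"
  proof
    fix y
    have "(\<integral>x. 1 / cosh x * h y * cos (c * y * x) \<partial>lborel) = h y * (\<integral>x. cos (c * y * x) / cosh x \<partial>lborel)"
      by (subst integral_mult_right_zero[symmetric]) (simp add: ac_simps)
    also have "\<dots> = pi * (h y / cosh (g * y))"
      unfolding fourier_sech by (simp add: c_def)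
    finally show "(\<integral>x. 1 / cosh x * h y * cos (c * y * x) \<partial>lborel) = pi * (h y / cosh (g * y))" .
  qed
  also have "(\<lambda>x. \<integral>y. 1 / cosh x * h y * cos (c * y * x) \<partial>lborel)
    = (\<lambda>x. pi * sqrt pi * ((1 - 2 * g\<^sup>2 * x\<^sup>2) * exp (- (g\<^sup>2 * x\<^sup>2)) / cosh x))"
  proof
    fix x
    have "(\<integral>y. 1 / cosh x * h y * cos (c * y * x) \<partial>lborel) = 1 / cosh x * (\<integral>y. h y * cos (c * x * y) \<partial>lborel)"
      by (subst integral_mult_right_zero[symmetric]) (simp only: ac_simps)
    also have "(\<integral>y. h y * cos (c * x * y) \<partial>lborel)
        = (1 - (c * x)\<^sup>2 * pi\<^sup>2 / 2) * (pi * sqrt pi * exp (- ((c * x)\<^sup>2 * pi\<^sup>2 / 4)))"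
      unfolding h_def by (rule fourier_gauss_second_moment)
    also have "(c * x)\<^sup>2 * pi\<^sup>2 = 4 * (g\<^sup>2 * x\<^sup>2)"
      by (simp add: c_def power_mult_distrib power_divide)
    finally show "(\<integral>y. 1 / cosh x * h y * cos (c * y * x) \<partial>lborel)
      = pi * sqrt pi * ((1 - 2 * g\<^sup>2 * x\<^sup>2) * exp (- (g\<^sup>2 * x\<^sup>2)) / cosh x)"
      by (simp add: ac_simps)
  qed
  \<comment> \<open>The x-integral produced pi and the y-integral pi sqrt pi; cancelling pi leaves
    the sqrt pi of the claim.\<close>
  finally have "pi * (\<integral>y. h y / cosh (g * y) \<partial>lborel)
      = pi * (sqrt pi * (\<integral>x. (1 - 2 * g\<^sup>2 * x\<^sup>2) * exp (- (g\<^sup>2 * x\<^sup>2)) / cosh x \<partial>lborel))"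
    by (simp only: integral_mult_right_zero mult.assoc)
  thus ?thesis unfolding h_def mult_cancel_left using pi_neq_zero by metis
qed

section \<open>Integration by parts on both sides\<close>

lemma abs_sinh_div_cosh_le_1: "\<bar>sinh x / (cosh x)\<^sup>2\<bar> \<le> (1 :: real)"
proof -
  have "\<bar>sinh x\<bar> \<le> cosh x"
    using sinh_le_cosh_real[of "\<bar>x\<bar>"] by simp
  also have "\<dots> \<le> (cosh x)\<^sup>2"
    using cosh_real_ge_1[of x] by (simp add: power2_eq_square)
  finally show ?thesis by (simp add: abs_divide)
qed

text \<open>The function u - v + w is the derivative of -x exp (-x^2/pi^2) / cosh (g x).\<close>

lemma
  fixes g :: real
  defines "u \<equiv> \<lambda>x. x * (g * sinh (g * x) / (cosh (g * x))\<^sup>2) * exp (- (x\<^sup>2 / pi\<^sup>2))"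
    and "v \<equiv> \<lambda>x. exp (- (x\<^sup>2 / pi\<^sup>2)) / cosh (g * x)"
    and "w \<equiv> \<lambda>x. 2 * x\<^sup>2 / pi\<^sup>2 * exp (- (x\<^sup>2 / pi\<^sup>2)) / cosh (g * x)"
  shows integrable_gauss_sinh: "integrable lborel u"
    and integrable_gauss_sech: "integrable lborel v"
    and integral_gauss_by_parts: "integral\<^sup>L lborel u = integral\<^sup>L lborel v - integral\<^sup>L lborel w"
proof -
  \<comment> \<open>All decay is taken from the Gaussian and sech is only bounded by 1, so g = 0
    needs no separate case.\<close>
  have sech: "\<bar>q / cosh (g * x)\<bar> \<le> \<bar>q\<bar>" for q x
    using divide_left_mono[OF cosh_real_ge_1[of "g * x"] abs_ge_zero[of q]] by (simp add: abs_divide)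
  show u: "integrable lborel u" unfolding u_def
  proof (rule integrable_gauss)
    show "continuous_on UNIV (\<lambda>x. x * (g * sinh (g * x) / (cosh (g * x))\<^sup>2))"
      by (intro continuous_intros) auto
    show "\<bar>x * (g * sinh (g * x) / (cosh (g * x))\<^sup>2)\<bar> \<le> \<bar>g\<bar> * (1 + x\<^sup>2)" for x
    proof -
      have "\<bar>x * (g * sinh (g * x) / (cosh (g * x))\<^sup>2)\<bar> = \<bar>g\<bar> * (\<bar>x\<bar> * \<bar>sinh (g * x) / (cosh (g * x))\<^sup>2\<bar>)"
        by (simp add: abs_mult abs_divide)
      also have "\<dots> \<le> \<bar>g\<bar> * ((1 + x\<^sup>2) * 1)"
        by (intro mult_left_mono mult_mono abs_le_one_plus_square abs_sinh_div_cosh_le_1) auto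
      finally show ?thesis by simp
    qed
  qed
  have "integrable lborel (\<lambda>x. 1 / cosh (g * x) * exp (- (x\<^sup>2 / pi\<^sup>2)))"
  proof (rule integrable_gauss)
    show "\<bar>1 / cosh (g * x)\<bar> \<le> 1 * (1 + x\<^sup>2)" for x
      using order_trans[OF sech[of 1 x], of "1 + x\<^sup>2"] by simp
  qed (auto intro!: continuous_intros)
  thus v: "integrable lborel v" by (simp add: v_def)
  have "integrable lborel (\<lambda>x. 2 * x\<^sup>2 / pi\<^sup>2 / cosh (g * x) * exp (- (x\<^sup>2 / pi\<^sup>2)))"
  proof (rule integrable_gauss)
    show "\<bar>2 * x\<^sup>2 / pi\<^sup>2 / cosh (g * x)\<bar> \<le> 1 * (1 + x\<^sup>2)" for x
      by (rule order_trans[OF sech]) (use mult_right_mono[OF two_div_pi_square_le_1, of "x\<^sup>2"] in simp)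
  qed (auto intro!: continuous_intros)
  hence w: "integrable lborel w" by (simp add: w_def)
  have "(\<integral>x. u x - v x + w x \<partial>lborel) = 0"
  proof (rule integral_derivative_eq_0)
    show "((\<lambda>x. - (x / cosh (g * x)) * exp (- (x\<^sup>2 / pi\<^sup>2))) has_real_derivative u x - v x + w x) (at x)" for x
      unfolding u_def v_def w_def
      by (rule derivative_eq_intros refl | simp)+ (simp add: field_simps power2_eq_square power4_eq_xxxx)
    show "continuous_on UNIV (\<lambda>x. u x - v x + w x)"
      unfolding u_def v_def w_def by (intro continuous_intros) auto
    show "integrable lborel (\<lambda>x. u x - v x + w x)" using u v w by simp
    show "\<bar>- (x / cosh (g * x)) * exp (- (x\<^sup>2 / pi\<^sup>2))\<bar> * (1 + x\<^sup>2) \<le> 1 * (4 * pi ^ 4)" for x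
      using order_trans[OF sech abs_le_one_plus_square[of x]] by (intro gauss_bound) simp
  qed
  thus "integral\<^sup>L lborel u = integral\<^sup>L lborel v - integral\<^sup>L lborel w"
    using u v w by simp
qed

text \<open>Here u - v is the derivative of -x exp (-g^2 x^2) / cosh x. The roles are exchanged:
  sech supplies the decay and the Gaussian, constant when g = 0, is only bounded by 1.\<close>

lemma
  fixes g :: real
  defines "u \<equiv> \<lambda>x. x * (sinh x / (cosh x)\<^sup>2) * exp (- (g\<^sup>2 * x\<^sup>2))"
    and "v \<equiv> \<lambda>x. (1 - 2 * g\<^sup>2 * x\<^sup>2) * exp (- (g\<^sup>2 * x\<^sup>2)) / cosh x"
  shows integrable_sech_sinh: "integrable lborel u"
    and integral_sech_by_parts: "integral\<^sup>L lborel u = integral\<^sup>L lborel v"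
proof -
  have gauss: "\<bar>q * exp (- (g\<^sup>2 * x\<^sup>2))\<bar> \<le> \<bar>q\<bar>" for q x
    by (simp add: abs_mult mult_left_le)
  \<comment> \<open>One cosh of the squared denominator goes into tanh, bounded by 1; the other is
    the weight.\<close>
  have "integrable lborel (\<lambda>x. x * (sinh x / cosh x) * exp (- (g\<^sup>2 * x\<^sup>2)) / cosh x)"
  proof (rule integrable_sech)
    show "\<bar>x * (sinh x / cosh x) * exp (- (g\<^sup>2 * x\<^sup>2))\<bar> \<le> 1 * (1 + x\<^sup>2)" for x
    proof (rule order_trans[OF gauss])
      have "\<bar>sinh x\<bar> \<le> cosh x"
        using sinh_le_cosh_real[of "\<bar>x\<bar>"] by simp
      hence "\<bar>x\<bar> * \<bar>sinh x / cosh x\<bar> \<le> (1 + x\<^sup>2) * 1"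
        by (intro mult_mono abs_le_one_plus_square) (auto simp: abs_divide)
      thus "\<bar>x * (sinh x / cosh x)\<bar> \<le> 1 * (1 + x\<^sup>2)" by (simp add: abs_mult)
    qed
  qed (auto intro!: continuous_intros)
  thus u: "integrable lborel u" by (simp add: u_def power2_eq_square)
  have v: "integrable lborel v" unfolding v_def
  proof (rule integrable_sech)
    show "\<bar>(1 - 2 * g\<^sup>2 * x\<^sup>2) * exp (- (g\<^sup>2 * x\<^sup>2))\<bar> \<le> (1 + 2 * g\<^sup>2) * (1 + x\<^sup>2)" for x
    proof (rule order_trans[OF gauss])
      have "0 \<le> 2 * g\<^sup>2 * x\<^sup>2" "0 \<le> g\<^sup>2" "0 \<le> x\<^sup>2" by simp_all
      thus "\<bar>1 - 2 * g\<^sup>2 * x\<^sup>2\<bar> \<le> (1 + 2 * g\<^sup>2) * (1 + x\<^sup>2)"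
        unfolding distrib_left distrib_right by linarith
    qed
  qed (auto intro!: continuous_intros)
  have "(\<integral>x. u x - v x \<partial>lborel) = 0"
  proof (rule integral_derivative_eq_0)
    show "((\<lambda>x. - (x * exp (- (g\<^sup>2 * x\<^sup>2))) / cosh x) has_real_derivative u x - v x) (at x)" for x
      unfolding u_def v_def
      by (rule derivative_eq_intros refl | simp)+ (simp add: field_simps power2_eq_square power4_eq_xxxx)
    show "continuous_on UNIV (\<lambda>x. u x - v x)"
      unfolding u_def v_def by (intro continuous_intros) auto
    show "integrable lborel (\<lambda>x. u x - v x)" using u v by simp
    show "\<bar>- (x * exp (- (g\<^sup>2 * x\<^sup>2))) / cosh x\<bar> * (1 + x\<^sup>2) \<le> 1 * 512" for x
      by (rule weighted_bound[OF square_le_cosh])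
         (use order_trans[OF gauss abs_le_one_plus_square[of x]] in auto)
  qed
  thus "integral\<^sup>L lborel u = integral\<^sup>L lborel v"
    using u v by simp
qed

section \<open>The identity on the half-line\<close>

theorem mainTheorem11:
  fixes g :: real
  shows "(\<lambda>x::real. x * (g * sinh (g * x) / (cosh (g * x))^2 * exp (- (x^2 / pi^2))
              + sqrt pi * sinh x / (cosh x)^2 * exp (- (g^2 * x^2)))) integrable_on {0..}
    \<and> (\<lambda>x::real. exp (- (x^2 / pi^2)) / cosh (g * x)) integrable_on {0..}
    \<and> integral {0..} (\<lambda>x::real. x * (g * sinh (g * x) / (cosh (g * x))^2 * exp (- (x^2 / pi^2))
              + sqrt pi * sinh x / (cosh x)^2 * exp (- (g^2 * x^2))))
      = integral {0..} (\<lambda>x::real. exp (- (x^2 / pi^2)) / cosh (g * x))"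
    (is "?f integrable_on _ \<and> ?h integrable_on _ \<and> _")
proof -
  let ?u = "\<lambda>x. x * (g * sinh (g * x) / (cosh (g * x))\<^sup>2) * exp (- (x\<^sup>2 / pi\<^sup>2))"
  let ?v = "\<lambda>x. x * (sinh x / (cosh x)\<^sup>2) * exp (- (g\<^sup>2 * x\<^sup>2))"
  have f: "?f = (\<lambda>x. ?u x + sqrt pi * ?v x)"
    by (simp add: fun_eq_iff algebra_simps)
  have f_int: "integrable lborel ?f"
    unfolding f by (intro Bochner_Integration.integrable_add integrable_mult_right integrable_gauss_sinh integrable_sech_sinh)
  have f_even: "?f (- x) = ?f x" for x
    by (simp add: algebra_simps)
  have h_int: "integrable lborel ?h"
    by (rule integrable_gauss_sech)
  have "integral\<^sup>L lborel ?f = integral\<^sup>L lborel ?u + sqrt pi * integral\<^sup>L lborel ?v"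
    unfolding f
    by (simp only: Bochner_Integration.integral_add[OF integrable_gauss_sinh
          integrable_mult_right[OF integrable_sech_sinh]] integral_mult_right_zero)
  \<comment> \<open>Integration by parts leaves the second-moment integral \<open>w\<close> with a
    minus sign in the first summand; duality turns the second summand into the same integral with a
    plus sign.\<close>
  also have "\<dots> = integral\<^sup>L lborel ?h"
    unfolding integral_gauss_by_parts integral_sech_by_parts integral_sech_gauss_dual by simp
  finally show ?thesis
    using integral_even_atLeast_0[OF f_int f_even] integral_even_atLeast_0[OF h_int] by simp
qed

end
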